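(* Let $(V,\nu,\tau)$ be a characteristic Šerstnev space. Then $(V,\nu,\tau)$ is normable if, and only if, the null vector $\theta$ of $V$ has a convex $\mathcal{D}$-bounded neighbourhood (in the strong topology).
   Context: Vector spaces are real; $\theta$ is the null vector of $V$. $\Delta^+$ is the set of distance distribution functions: functions $F:[-\infty,+\infty]\to[0,1]$ that are nondecreasing, left-continuous on $\mathbf{R}$, with $F(-\infty)=0$, $F(0)=0$, $F(+\infty)=1$. $\mathcal{D}^+$ is the set of $F\in\Delta^+$ with $\lim_{x\to+\infty}F(x)=1$. $\Delta^+$ carries the pointwise order and the (metrizable) topology of weak convergence. $\varepsilon_0\in\Delta^+$ is given by $\varepsilon_0(t)=0$ for $t\le 0$ and $\varepsilon_0(t)=1$ for $t>0$. A triangle function is a map $\tau:\Delta^+\times\Delta^+\to\Delta^+$ that is commutative, associative, nondecreasing in each variable and has $\varepsilon_0$ as identity. A Probabilistic Normed (PN) space is a quadruple $(V,\nu,\tau,\tau^* )$ where $V$ is a vector space, $\tau,\tau^*$ are continuous triangle functions with $\tau\le\tau^*$, and $\nu:V\to\Delta^+$, $p\mapsto\nu_p$, satisfies, for all $p,q\in V$: (N1) $\nu_p=\varepsilon_0$ iff $p=\theta$; (N2) $\nu_{-p}=\nu_p$; (N3) $\nu_{p+q}\ge\tau(\nu_p,\nu_q)$; (N4) $\nu_p\le\tau^*(\nu_{\lambda p},\nu_{(1-\lambda)p})$ for every $\lambda\in[0,1]$. A PN space is called a Šerstnev space, denoted $(V,\nu,\tau)$, if it satisfies (N1), (N3) and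 the condition (which implies (N2) and (N4)): $\nu_{\alpha p}(x)=\nu_p(x/|\alpha|)$ for all $p\in V$, $\alpha\in\mathbf{R}\setminus\{0\}$, $x>0$. A PN space is characteristic if $\nu_p\in\mathcal{D}^+$ for every $p\in V$. The strong topology on $V$ is the topology generated by the strong neighbourhoods $N_p(t)=\{q\in V:\nu_{p-q}(t)>1-t\}$, $p\in V$, $t>0$ (these form a neighbourhood base at $p$). The PN space is normable if there is a norm on $V$ that generates the strong topology. A subset $A\subseteq V$ is $\mathcal{D}$-bounded if there is $G\in\mathcal{D}^+$ such that $\nu_p\ge G$ for every $p\in A$. *)

theory Defs
  imports "HOL-Analysis.Analysis" "HOL-Probability.Weak_Convergence"
begin

definition Delta_plus :: "(ereal \<Rightarrow> real) set" where
  "Delta_plus = {F. mono F \<and> range F \<subseteq> {0..1} \<and>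
     (\<forall>x::real. continuous (at_left x) (\<lambda>y. F (ereal y))) \<and>
     F (-\<infinity>) = 0 \<and> F 0 = 0 \<and> F \<infinity> = 1}"

definition D_plus :: "(ereal \<Rightarrow> real) set" where
  "D_plus = {F \<in> Delta_plus. ((\<lambda>x::real. F (ereal x)) \<longlongrightarrow> 1) at_top}"

definition eps0 :: "ereal \<Rightarrow> real" where
  "eps0 t = (if t \<le> 0 then 0 else 1)"

text \<open>Weak convergence in \<open>Delta_plus\<close> is convergence at the real continuity points of the
  limit; at the two infinite points all members of \<open>Delta_plus\<close> agree.\<close>

definition ddf_conv :: "(nat \<Rightarrow> ereal \<Rightarrow> real) \<Rightarrow> (ereal \<Rightarrow> real) \<Rightarrow> bool" where
  "ddf_conv Fs F \<longleftrightarrow> weak_conv (\<lambda>n x. Fs n (ereal x)) (\<lambda>x. F (ereal x))"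

text \<open>The topology of weak convergence is metrizable, hence determined by its convergent
  sequences: a set is open iff every sequence converging weakly to one of its points is eventually
  in it. The lemma \<open>limitin_weak_topology\<close> below confirms that the sequences converging in this
  topology are exactly the weakly convergent ones.\<close>

definition weak_topology :: "(ereal \<Rightarrow> real) topology" where
  "weak_topology = topology (\<lambda>U. U \<subseteq> Delta_plus \<and>
     (\<forall>F\<in>U. \<forall>Fs. range Fs \<subseteq> Delta_plus \<longrightarrow> ddf_conv Fs F \<longrightarrow> (\<forall>\<^sub>F n in sequentially. Fs n \<in> U)))"

lemma openin_weak_topology:
  "openin weak_topology U \<longleftrightarrow> U \<subseteq> Delta_plus \<and>
     (\<forall>F\<in>U. \<forall>Fs. range Fs \<subseteq> Delta_plus \<longrightarrow> ddf_conv Fs F \<longrightarrow> (\<forall>\<^sub>F n in sequentially. Fs n \<in> U))"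
proof -
  have "istopology (\<lambda>U. U \<subseteq> Delta_plus \<and>
     (\<forall>F\<in>U. \<forall>Fs. range Fs \<subseteq> Delta_plus \<longrightarrow> ddf_conv Fs F \<longrightarrow> (\<forall>\<^sub>F n in sequentially. Fs n \<in> U)))"
    (is "istopology ?P")
    unfolding istopology_def
  proof (rule conjI)
    show "\<forall>S T. ?P S \<longrightarrow> ?P T \<longrightarrow> ?P (S \<inter> T)"
      by (auto simp: eventually_conj_iff)
    have "?P (\<Union>K)" if K: "\<And>S. S \<in> K \<Longrightarrow> ?P S" for K
    proof (intro conjI ballI allI impI)
      show "\<Union>K \<subseteq> Delta_plus" using K by blast
    next
      fix F Fs assume "F \<in> \<Union>K" and Fs: "range Fs \<subseteq> Delta_plus" "ddf_conv Fs F"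
      then obtain S where S: "S \<in> K" "F \<in> S" by blast
      then have "\<forall>\<^sub>F n in sequentially. Fs n \<in> S" using K Fs by blast
      then show "\<forall>\<^sub>F n in sequentially. Fs n \<in> \<Union>K"
        by eventually_elim (use S in blast)
    qed
    then show "\<forall>K. (\<forall>S\<in>K. ?P S) \<longrightarrow> ?P (\<Union>K)" by simp
  qed
  then show ?thesis
    unfolding weak_topology_def by (simp add: topology_inverse')
qed

lemma topspace_weak_topology: "topspace weak_topology = Delta_plus"
proof -
  have "openin weak_topology Delta_plus"
    unfolding openin_weak_topology by (auto intro: always_eventually)
  moreover have "openin weak_topology (topspace weak_topology)" by simp
  ultimately show ?thesis
    unfolding openin_weak_topology by (metis openin_subset openin_weak_topology subset_antisym)
qed

lemma limitin_weak_topology: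
  assumes Fs: "range Fs \<subseteq> Delta_plus" and F: "F \<in> Delta_plus"
  shows "limitin weak_topology Fs F sequentially \<longleftrightarrow> ddf_conv Fs F"
proof
  assume "ddf_conv Fs F"
  then show "limitin weak_topology Fs F sequentially"
    using assms by (auto simp: limitin_def topspace_weak_topology openin_weak_topology)
next
  have cont_dense: "\<exists>z. x < z \<and> z < y \<and> isCont (\<lambda>u. H (ereal u)) z"
    if H: "H \<in> Delta_plus" and xy: "x < y" for H and x y :: real
  proof -
    have "mono (\<lambda>u. H (ereal u))"
      using H by (auto simp: Delta_plus_def mono_def)
    then have "countable {a. \<not> isCont (\<lambda>u. H (ereal u)) a}"
      by (rule mono_ctble_discont)
    then have "\<exists>z\<in>{x<..<y}. z \<notin> {a. \<not> isCont (\<lambda>u. H (ereal u)) a}"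
      by (meson countable_subset subsetI uncountable_open_interval xy)
    then show ?thesis by auto
  qed
  have op_gt: "openin weak_topology {H \<in> Delta_plus. a < H (ereal x)}" for a x
    unfolding openin_weak_topology
  proof (intro conjI ballI allI impI)
    fix H Hs assume H: "H \<in> {H \<in> Delta_plus. a < H (ereal x)}"
      and Hs: "range Hs \<subseteq> Delta_plus" "ddf_conv Hs H"
    have "((\<lambda>y. H (ereal y)) \<longlongrightarrow> H (ereal x)) (at_left x)"
      using H by (auto simp: Delta_plus_def continuous_within)
    then have "\<forall>\<^sub>F y in at_left x. a < H (ereal y)"
      using H by (auto dest: order_tendstoD)
    then obtain b where b: "b < x" "\<And>y. b < y \<Longrightarrow> y < x \<Longrightarrow> a < H (ereal y)"
      by (auto simp: eventually_at_left_field)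
    obtain z where z: "b < z" "z < x" "isCont (\<lambda>u. H (ereal u)) z"
      using cont_dense[of H b x] H b by auto
    have "(\<lambda>n. Hs n (ereal z)) \<longlonglongrightarrow> H (ereal z)"
      using Hs z by (auto simp: ddf_conv_def weak_conv_def)
    then have "\<forall>\<^sub>F n in sequentially. a < Hs n (ereal z)"
      using b z by (auto dest: order_tendstoD)
    then show "\<forall>\<^sub>F n in sequentially. Hs n \<in> {H \<in> Delta_plus. a < H (ereal x)}"
    proof eventually_elim
      case (elim n)
      have "Hs n \<in> Delta_plus" using Hs by auto
      moreover from this have "Hs n (ereal z) \<le> Hs n (ereal x)"
        using z by (auto simp: Delta_plus_def mono_def)
      ultimately show ?case using elim by auto
    qed
  qed auto
  have op_lt: "openin weak_topology {H \<in> Delta_plus. \<exists>y>x. H (ereal y) < a}" for a x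
    unfolding openin_weak_topology
  proof (intro conjI ballI allI impI)
    fix H Hs assume "H \<in> {H \<in> Delta_plus. \<exists>y>x. H (ereal y) < a}"
      and Hs: "range Hs \<subseteq> Delta_plus" "ddf_conv Hs H"
    then obtain y where y: "H \<in> Delta_plus" "x < y" "H (ereal y) < a" by auto
    obtain z where z: "x < z" "z < y" "isCont (\<lambda>u. H (ereal u)) z"
      using cont_dense[of H x y] y by auto
    have "H (ereal z) \<le> H (ereal y)"
      using y z by (auto simp: Delta_plus_def mono_def)
    then have "H (ereal z) < a" using y by simp
    moreover have "(\<lambda>n. Hs n (ereal z)) \<longlonglongrightarrow> H (ereal z)"
      using Hs z by (auto simp: ddf_conv_def weak_conv_def)
    ultimately have "\<forall>\<^sub>F n in sequentially. Hs n (ereal z) < a"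
      by (auto dest: order_tendstoD)
    then show "\<forall>\<^sub>F n in sequentially. Hs n \<in> {H \<in> Delta_plus. \<exists>y>x. H (ereal y) < a}"
      by eventually_elim (use Hs z in auto)
  qed auto
  assume lim: "limitin weak_topology Fs F sequentially"
  show "ddf_conv Fs F"
    unfolding ddf_conv_def weak_conv_def
  proof (intro allI impI)
    fix x assume x: "isCont (\<lambda>u. F (ereal u)) x"
    show "(\<lambda>n. Fs n (ereal x)) \<longlonglongrightarrow> F (ereal x)"
    proof (rule order_tendstoI)
      fix a assume "a < F (ereal x)"
      then have "\<forall>\<^sub>F n in sequentially. Fs n \<in> {H \<in> Delta_plus. a < H (ereal x)}"
        using lim op_gt[of a x] F unfolding limitin_def by blast
      then show "\<forall>\<^sub>F n in sequentially. a < Fs n (ereal x)"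
        by eventually_elim simp
    next
      fix a assume a: "F (ereal x) < a"
      have "((\<lambda>u. F (ereal u)) \<longlongrightarrow> F (ereal x)) (at_right x)"
        using x by (auto simp: isCont_def intro: filterlim_mono at_le)
      then have "\<forall>\<^sub>F u in at_right x. F (ereal u) < a"
        using a by (auto dest: order_tendstoD)
      then obtain b where b: "b > x" "\<And>y. x < y \<Longrightarrow> y < b \<Longrightarrow> F (ereal y) < a"
        by (auto simp: eventually_at_right_field)
      then have "\<exists>y>x. F (ereal y) < a"
        by (meson dense)
      then have "\<forall>\<^sub>F n in sequentially. Fs n \<in> {H \<in> Delta_plus. \<exists>y>x. H (ereal y) < a}"
        using lim op_lt[of x a] F unfolding limitin_def by blast
      then show "\<forall>\<^sub>F n in sequentially. Fs n (ereal x) < a"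
      proof eventually_elim
        case (elim n)
        then obtain y where y: "Fs n \<in> Delta_plus" "x < y" "Fs n (ereal y) < a" by auto
        then have "Fs n (ereal x) \<le> Fs n (ereal y)"
          by (auto simp: Delta_plus_def mono_def)
        with y show ?case by simp
      qed
    qed
  qed
qed

definition triangle_function :: "((ereal \<Rightarrow> real) \<Rightarrow> (ereal \<Rightarrow> real) \<Rightarrow> (ereal \<Rightarrow> real)) \<Rightarrow> bool" where
  "triangle_function \<tau> \<longleftrightarrow>
     (\<forall>F\<in>Delta_plus. \<forall>G\<in>Delta_plus. \<tau> F G \<in> Delta_plus) \<and>
     (\<forall>F\<in>Delta_plus. \<forall>G\<in>Delta_plus. \<tau> F G = \<tau> G F) \<and>
     (\<forall>F\<in>Delta_plus. \<forall>G\<in>Delta_plus. \<forall>H\<in>Delta_plus. \<tau> (\<tau> F G) H = \<tau> F (\<tau> G H)) \<and>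
     (\<forall>F\<in>Delta_plus. \<forall>F'\<in>Delta_plus. \<forall>G\<in>Delta_plus.
        F \<le> F' \<longrightarrow> \<tau> F G \<le> \<tau> F' G \<and> \<tau> G F \<le> \<tau> G F') \<and>
     (\<forall>F\<in>Delta_plus. \<tau> F eps0 = F \<and> \<tau> eps0 F = F)"

definition continuous_triangle_function ::
    "((ereal \<Rightarrow> real) \<Rightarrow> (ereal \<Rightarrow> real) \<Rightarrow> (ereal \<Rightarrow> real)) \<Rightarrow> bool" where
  "continuous_triangle_function \<tau> \<longleftrightarrow> triangle_function \<tau> \<and>
     continuous_map (prod_topology weak_topology weak_topology) weak_topology (\<lambda>(F, G). \<tau> F G)"

definition PN_space ::
    "('a::real_vector \<Rightarrow> ereal \<Rightarrow> real) \<Rightarrow>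
     ((ereal \<Rightarrow> real) \<Rightarrow> (ereal \<Rightarrow> real) \<Rightarrow> (ereal \<Rightarrow> real)) \<Rightarrow>
     ((ereal \<Rightarrow> real) \<Rightarrow> (ereal \<Rightarrow> real) \<Rightarrow> (ereal \<Rightarrow> real)) \<Rightarrow> bool" where
  "PN_space \<nu> \<tau> \<tau>' \<longleftrightarrow>
     continuous_triangle_function \<tau> \<and> continuous_triangle_function \<tau>' \<and>
     (\<forall>F\<in>Delta_plus. \<forall>G\<in>Delta_plus. \<tau> F G \<le> \<tau>' F G) \<and>
     (\<forall>p. \<nu> p \<in> Delta_plus) \<and>
     (\<forall>p. \<nu> p = eps0 \<longleftrightarrow> p = 0) \<and>
     (\<forall>p. \<nu> (- p) = \<nu> p) \<and>
     (\<forall>p q. \<nu> (p + q) \<ge> \<tau> (\<nu> p) (\<nu> q)) \<and>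
     (\<forall>p. \<forall>l\<in>{0..1::real}. \<nu> p \<le> \<tau>' (\<nu> (l *\<^sub>R p)) (\<nu> ((1 - l) *\<^sub>R p)))"

text \<open>The second triangle function is not part of the notation for a Serstnev space, so it is
  quantified existentially. This does not restrict \<open>\<tau>\<close>: pointwise minimum is the greatest
  triangle function, it is continuous, and the homogeneity condition below makes it satisfy the
  last condition of \<open>PN_space\<close>.\<close>

definition Serstnev_space ::
    "('a::real_vector \<Rightarrow> ereal \<Rightarrow> real) \<Rightarrow>
     ((ereal \<Rightarrow> real) \<Rightarrow> (ereal \<Rightarrow> real) \<Rightarrow> (ereal \<Rightarrow> real)) \<Rightarrow> bool" where
  "Serstnev_space \<nu> \<tau> \<longleftrightarrow> (\<exists>\<tau>'. PN_space \<nu> \<tau> \<tau>') \<and>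
     (\<forall>p. \<forall>\<alpha>::real. \<forall>x::real. \<alpha> \<noteq> 0 \<longrightarrow> x > 0 \<longrightarrow>
        \<nu> (\<alpha> *\<^sub>R p) (ereal x) = \<nu> p (ereal (x / \<bar>\<alpha>\<bar>)))"

definition characteristic :: "('a \<Rightarrow> ereal \<Rightarrow> real) \<Rightarrow> bool" where
  "characteristic \<nu> \<longleftrightarrow> (\<forall>p. \<nu> p \<in> D_plus)"

definition strong_nbhd :: "('a::real_vector \<Rightarrow> ereal \<Rightarrow> real) \<Rightarrow> 'a \<Rightarrow> real \<Rightarrow> 'a set" where
  "strong_nbhd \<nu> p t = {q. \<nu> (p - q) (ereal t) > 1 - t}"

definition strong_topology :: "('a::real_vector \<Rightarrow> ereal \<Rightarrow> real) \<Rightarrow> 'a topology" where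
  "strong_topology \<nu> = topology_generated_by {strong_nbhd \<nu> p t | p t. t > 0}"

definition is_norm :: "('a::real_vector \<Rightarrow> real) \<Rightarrow> bool" where
  "is_norm N \<longleftrightarrow> (\<forall>x. N x \<ge> 0) \<and> (\<forall>x. N x = 0 \<longleftrightarrow> x = 0) \<and>
     (\<forall>c x. N (c *\<^sub>R x) = \<bar>c\<bar> * N x) \<and> (\<forall>x y. N (x + y) \<le> N x + N y)"

lemma Metric_space_is_norm:
  assumes "is_norm N"
  shows "Metric_space UNIV (\<lambda>x y. N (x - y))"
proof
  fix x y z
  show "0 \<le> N (x - y)" using assms by (simp add: is_norm_def)
  have "N ((- 1) *\<^sub>R (x - y)) = \<bar>- 1\<bar> * N (x - y)"
    using assms unfolding is_norm_def by blast
  then show "N (x - y) = N (y - x)" by simp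
  show "N (x - y) = 0 \<longleftrightarrow> x = y" using assms by (simp add: is_norm_def)
  have "N ((x - y) + (y - z)) \<le> N (x - y) + N (y - z)"
    using assms unfolding is_norm_def by blast
  then show "N (x - z) \<le> N (x - y) + N (y - z)" by simp
qed

definition normable :: "('a::real_vector \<Rightarrow> ereal \<Rightarrow> real) \<Rightarrow> bool" where
  "normable \<nu> \<longleftrightarrow> (\<exists>N. is_norm N \<and>
     Metric_space.mtopology UNIV (\<lambda>x y. N (x - y)) = strong_topology \<nu>)"

definition D_bounded :: "('a \<Rightarrow> ereal \<Rightarrow> real) \<Rightarrow> 'a set \<Rightarrow> bool" where
  "D_bounded \<nu> A \<longleftrightarrow> (\<exists>G\<in>D_plus. \<forall>p\<in>A. \<nu> p \<ge> G)"

end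

theory Submission
  imports Defs
begin

text \<open>
  Continuity of \<open>\<tau>\<close> at \<open>(F, eps0)\<close> makes the strong neighbourhoods a base of open sets, so both
  topologies are compared through neighbourhoods of the null vector. By homogeneity
  \<open>\<nu>\<^bsub>p/r\<^esub>(x) = \<nu>\<^bsub>p\<^esub>(r x)\<close>, a set is \<open>D\<close>-bounded when it is absorbed by every strong neighbourhood
  of the null vector, so norm balls are \<open>D\<close>-bounded; conversely, if \<open>A\<close> is a convex \<open>D\<close>-bounded
  neighbourhood, the Minkowski functional of \<open>A \<inter> -A\<close> is a norm generating the strong topology.
\<close>

section \<open>Minkowski functionals\<close>

text \<open>\<open>Inf\<close> of an empty set of reals carries no information, so the estimates
  below assume absorption of \<open>p\<close>, i.e.
  \<open>\<exists>r>0. p /\<^sub>R r \<in> K\<close>, wherever nonemptiness matters.\<close>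

definition gauge_fun :: "'a::real_vector set \<Rightarrow> 'a \<Rightarrow> real" where
  "gauge_fun K p = Inf {r. 0 < r \<and> p /\<^sub>R r \<in> K}"

lemma bdd_below_gauge_set: "bdd_below {r::real. 0 < r \<and> P r}"
  by (rule bdd_belowI[of _ 0]) auto

lemma gauge_fun_le: "0 < r \<Longrightarrow> p /\<^sub>R r \<in> K \<Longrightarrow> gauge_fun K p \<le> r"
  unfolding gauge_fun_def by (rule cInf_lower) (auto simp: bdd_below_gauge_set)

lemma gauge_fun_lessE:
  assumes "\<exists>r>0. p /\<^sub>R r \<in> K" "gauge_fun K p < e"
  obtains r where "0 < r" "r < e" "p /\<^sub>R r \<in> K"
  using cInf_lessD[of "{r. 0 < r \<and> p /\<^sub>R r \<in> K}" e] assms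
  unfolding gauge_fun_def by blast

lemma gauge_fun_nonneg:
  assumes "\<exists>r>0. p /\<^sub>R r \<in> K"
  shows "0 \<le> gauge_fun K p"
  unfolding gauge_fun_def by (rule cInf_greatest) (use assms in auto)

text \<open>Convexity yields the triangle inequality, symmetry the homogeneity under negative
  scalars, absorption a meaningful infimum. Definiteness does not follow from these, since
  \<open>K\<close> could contain a whole line, so it enters as \<open>sep\<close>.\<close>

lemma is_norm_gauge_fun:
  fixes K :: "'a::real_vector set"
  assumes conv: "convex K" and sym: "\<And>p. p \<in> K \<Longrightarrow> - p \<in> K"
    and absb: "\<And>p. \<exists>r>0. p /\<^sub>R r \<in> K"
    and sep: "\<And>p. p \<noteq> 0 \<Longrightarrow> 0 < gauge_fun K p"
  shows "is_norm (gauge_fun K)"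
proof -
  have zero: "0 \<in> K" using absb[of 0] by simp
  have gauge0: "gauge_fun K 0 = 0"
  proof (rule antisym)
    show "gauge_fun K 0 \<le> 0"
      by (rule field_le_epsilon) (use zero in \<open>auto intro: gauge_fun_le\<close>)
  qed (rule gauge_fun_nonneg[OF absb])
  have scale_le: "gauge_fun K (c *\<^sub>R x) \<le> \<bar>c\<bar> * gauge_fun K x" if "c \<noteq> 0" for c x
  proof (rule field_le_epsilon)
    fix e :: real assume "0 < e"
    then have "gauge_fun K x < gauge_fun K x + e / \<bar>c\<bar>" using that by simp
    then obtain r where r: "0 < r" "r < gauge_fun K x + e / \<bar>c\<bar>" "x /\<^sub>R r \<in> K"
      using gauge_fun_lessE[OF absb] by blast
    \<comment> \<open>After normalisation only the sign of \<open>c\<close> survives, and symmetry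
      of \<open>K\<close> absorbs it.\<close>
    have "(c *\<^sub>R x) /\<^sub>R (\<bar>c\<bar> * r) = sgn c *\<^sub>R (x /\<^sub>R r)"
      using that by (simp add: sgn_if field_simps)
    also have "\<dots> \<in> K" using r(3) sym that by (auto simp: sgn_if)
    finally have "gauge_fun K (c *\<^sub>R x) \<le> \<bar>c\<bar> * r"
      using that r(1) by (intro gauge_fun_le) auto
    also have "\<dots> \<le> \<bar>c\<bar> * gauge_fun K x + e"
      using mult_left_mono[OF less_imp_le[OF r(2)], of "\<bar>c\<bar>"] that by (simp add: distrib_left)
    finally show "gauge_fun K (c *\<^sub>R x) \<le> \<bar>c\<bar> * gauge_fun K x + e" .
  qed
  have scale: "gauge_fun K (c *\<^sub>R x) = \<bar>c\<bar> * gauge_fun K x" for c x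
  proof (cases "c = 0")
    case False
    have "gauge_fun K x \<le> \<bar>inverse c\<bar> * gauge_fun K (c *\<^sub>R x)"
      using scale_le[of "inverse c" "c *\<^sub>R x"] False by simp
    then have "\<bar>c\<bar> * gauge_fun K x \<le> gauge_fun K (c *\<^sub>R x)"
      using False by (simp add: field_simps)
    with scale_le[OF False, of x] show ?thesis by simp
  qed (simp add: gauge0)
  have triangle: "gauge_fun K (x + y) \<le> gauge_fun K x + gauge_fun K y" for x y
  proof (rule field_le_epsilon)
    fix e :: real assume e: "0 < e"
    obtain r where r: "0 < r" "r < gauge_fun K x + e / 2" "x /\<^sub>R r \<in> K"
      by (rule gauge_fun_lessE[OF absb, of x "gauge_fun K x + e / 2"]) (use e in auto)
    obtain s where s: "0 < s" "s < gauge_fun K y + e / 2" "y /\<^sub>R s \<in> K"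
      by (rule gauge_fun_lessE[OF absb, of y "gauge_fun K y + e / 2"]) (use e in auto)
    \<comment> \<open>The weights are chosen so that the normalised sum is a convex combination of
      the two normalised summands.\<close>
    have "(r / (r + s)) *\<^sub>R (x /\<^sub>R r) + (s / (r + s)) *\<^sub>R (y /\<^sub>R s) \<in> K"
      using r s by (intro convexD[OF conv]) (auto simp: add_divide_distrib[symmetric])
    moreover have "(r / (r + s)) *\<^sub>R (x /\<^sub>R r) + (s / (r + s)) *\<^sub>R (y /\<^sub>R s) = (x + y) /\<^sub>R (r + s)"
      using r(1) s(1) by (simp add: scaleR_add_right inverse_eq_divide)
    ultimately have "gauge_fun K (x + y) \<le> r + s"
      using r s by (intro gauge_fun_le) auto
    with r s show "gauge_fun K (x + y) \<le> gauge_fun K x + gauge_fun K y + e" by simp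
  qed
  have "gauge_fun K x = 0 \<longleftrightarrow> x = 0" for x
    using sep[of x] gauge0 by (cases "x = 0") auto
  then show ?thesis
    by (simp add: is_norm_def gauge_fun_nonneg[OF absb] scale triangle)
qed

section \<open>Distance distribution functions\<close>

lemma Delta_plus_mono: "F \<in> Delta_plus \<Longrightarrow> x \<le> y \<Longrightarrow> F x \<le> F y"
  by (auto simp: Delta_plus_def mono_def)

lemma Delta_plus_nonneg: "F \<in> Delta_plus \<Longrightarrow> 0 \<le> F x"
  and Delta_plus_le_1: "F \<in> Delta_plus \<Longrightarrow> F x \<le> 1"
  using rangeI[of F x] by (auto simp: Delta_plus_def subset_iff)

lemma eps0_in_Delta_plus: "eps0 \<in> Delta_plus"
proof -
  have "continuous (at_left x) (\<lambda>y. eps0 (ereal y))" for x :: real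
  proof (cases "x \<le> 0")
    case True
    have "\<forall>\<^sub>F y in at_left x. eps0 (ereal y) = eps0 (ereal x)"
      unfolding eventually_at_left_field using True lt_ex by (auto simp: eps0_def)
    then show ?thesis unfolding continuous_within by (rule tendsto_eventually)
  next
    case False
    then have "\<forall>\<^sub>F y in at_left x. eps0 (ereal y) = eps0 (ereal x)"
      unfolding eventually_at_left_field by (auto simp: eps0_def intro!: exI[of _ 0])
    then show ?thesis unfolding continuous_within by (rule tendsto_eventually)
  qed
  then show ?thesis by (auto simp: Delta_plus_def eps0_def mono_def)
qed

text \<open>\<open>eps0\<close> is the largest element of \<open>Delta_plus\<close>, so a lower
  bound on the positive reals already forces equality.\<close>

lemma Delta_plus_eq_eps0:
  assumes F: "F \<in> Delta_plus" and one: "\<And>x::real. 0 < x \<Longrightarrow> 1 \<le> F (ereal x)"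
  shows "F = eps0"
proof
  fix t :: ereal
  show "F t = eps0 t"
  proof (cases "t \<le> 0")
    case True
    then have "F t \<le> F 0" by (rule Delta_plus_mono[OF F])
    with F True Delta_plus_nonneg[OF F, of t] show ?thesis by (simp add: Delta_plus_def eps0_def)
  next
    case False
    then have "1 \<le> F t"
      using F one by (cases t) (auto simp: Delta_plus_def)
    with False Delta_plus_le_1[OF F, of t] show ?thesis by (simp add: eps0_def)
  qed
qed

text \<open>Positivity of \<open>x\<close> allows it to be used later as part of a scale factor in
  the homogeneity condition.\<close>

lemma D_plus_eventually:
  assumes "G \<in> D_plus" "a < 1"
  obtains x :: real where "0 < x" "a < G (ereal x)"
proof -
  have "\<forall>\<^sub>F x::real in at_top. a < G (ereal x) \<and> 0 < x"
    using assms by (auto simp: D_plus_def intro: eventually_conj order_tendstoD eventually_gt_at_top)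
  then show thesis using that eventually_happens'[OF trivial_limit_at_top_linorder] by blast
qed

text \<open>Lower semicontinuity of evaluation, which rests on left continuity of the limit.\<close>
lemma ddf_conv_eventually_gt:
  assumes F: "F \<in> Delta_plus" and Fs: "\<And>n. Fs n \<in> Delta_plus"
    and lim: "ddf_conv Fs F" and a: "a < F (ereal x)"
  shows "\<forall>\<^sub>F n in sequentially. a < Fs n (ereal x)"
proof -
  have "((\<lambda>y. F (ereal y)) \<longlongrightarrow> F (ereal x)) (at_left x)"
    using F by (auto simp: Delta_plus_def continuous_within)
  then have "\<forall>\<^sub>F y in at_left x. a < F (ereal y)"
    using a by (auto dest: order_tendstoD)
  then obtain b where b: "b < x" "\<And>y. b < y \<Longrightarrow> y < x \<Longrightarrow> a < F (ereal y)"
    by (auto simp: eventually_at_left_field)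
  \<comment> \<open>Weak convergence speaks only at continuity points; a monotone function has
    countably many discontinuities, so a continuity point exists between \<open>b\<close> and
    \<open>x\<close>.\<close>
  have "mono (\<lambda>u. F (ereal u))" using F by (auto simp: Delta_plus_def mono_def)
  then have "countable {u. \<not> isCont (\<lambda>u. F (ereal u)) u}" by (rule mono_ctble_discont)
  then have "\<not> {b<..<x} \<subseteq> {u. \<not> isCont (\<lambda>u. F (ereal u)) u}"
    using b(1) countable_subset uncountable_open_interval by blast
  then obtain z where z: "b < z" "z < x" "isCont (\<lambda>u. F (ereal u)) z" by auto
  then have "(\<lambda>n. Fs n (ereal z)) \<longlonglongrightarrow> F (ereal z)"
    using lim by (auto simp: ddf_conv_def weak_conv_def)
  then have "\<forall>\<^sub>F n in sequentially. a < Fs n (ereal z)"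
    using b z by (auto dest: order_tendstoD)
  then show ?thesis
  proof eventually_elim
    case (elim n)
    also have "Fs n (ereal z) \<le> Fs n (ereal x)" using z by (intro Delta_plus_mono[OF Fs]) simp
    finally show ?case .
  qed
qed

text \<open>Translates shrinking strong radii into weak convergence. At a fixed \<open>x > 0\<close>
  the radius is eventually below \<open>x\<close>, and monotonicity squeezes the values between
  \<open>1 - inverse (real (Suc n))\<close> and 1; for \<open>x \<le> 0\<close> all values
  vanish.\<close>

lemma ddf_conv_eps0:
  assumes Fs: "\<And>n. Fs n \<in> Delta_plus"
    and gt: "\<And>n. 1 - inverse (real (Suc n)) < Fs n (ereal (inverse (real (Suc n))))"
  shows "ddf_conv Fs eps0"
  unfolding ddf_conv_def weak_conv_def
proof (intro allI impI)
  fix x :: real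
  show "(\<lambda>n. Fs n (ereal x)) \<longlonglongrightarrow> eps0 (ereal x)"
  proof (cases "x \<le> 0")
    case True
    then have "Fs n (ereal x) = 0" for n
      using Delta_plus_mono[OF Fs[of n], of "ereal x" 0] Delta_plus_nonneg[OF Fs, of n "ereal x"] Fs[of n]
      by (auto simp: Delta_plus_def)
    with True show ?thesis by (simp add: eps0_def)
  next
    case False
    have lim0: "(\<lambda>n. inverse (real (Suc n))) \<longlonglongrightarrow> 0" by (rule LIMSEQ_inverse_real_of_nat)
    then have "\<forall>\<^sub>F n in sequentially. inverse (real (Suc n)) < x"
      using False by (intro order_tendstoD(2)) auto
    then have low: "\<forall>\<^sub>F n in sequentially. 1 - inverse (real (Suc n)) \<le> Fs n (ereal x)"
    proof eventually_elim
      case (elim n)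
      then have "Fs n (ereal (inverse (real (Suc n)))) \<le> Fs n (ereal x)"
        by (intro Delta_plus_mono[OF Fs]) simp
      with gt[of n] show ?case by simp
    qed
    have lim1: "(\<lambda>n. 1 - inverse (real (Suc n))) \<longlonglongrightarrow> 1"
      using tendsto_diff[OF tendsto_const lim0, of 1] by simp
    have "(\<lambda>n. Fs n (ereal x)) \<longlonglongrightarrow> 1"
      by (rule tendsto_sandwich[OF low _ lim1 tendsto_const]) (simp add: Delta_plus_le_1 Fs)
    with False show ?thesis by (simp add: eps0_def)
  qed
qed

text \<open>The bound is the left-continuous modification of the pointwise infimum over \<open>A\<close>.\<close>
lemma D_boundedI:
  assumes ne: "A \<noteq> {}" and \<nu>: "\<And>p. p \<in> A \<Longrightarrow> \<nu> p \<in> Delta_plus"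
    and unif: "\<And>e. 0 < e \<Longrightarrow> \<exists>x::real. \<forall>p\<in>A. 1 - e \<le> \<nu> p (ereal x)"
  shows "D_bounded \<nu> A"
proof -
  define H where "H y = (INF p\<in>A. \<nu> p (ereal y))" for y :: real
  define G where "G z = (if z \<le> 0 then 0 else SUP y\<in>{y. ereal y < z}. H y)" for z :: ereal
  have H_le: "H y \<le> \<nu> p (ereal y)" if "p \<in> A" for p y
    unfolding H_def using that
    by (intro cINF_lower bdd_belowI[of _ 0]) (auto dest: \<nu> Delta_plus_nonneg)
  have le_H: "c \<le> H y" if "\<And>p. p \<in> A \<Longrightarrow> c \<le> \<nu> p (ereal y)" for c y
    unfolding H_def using that ne by (intro cINF_greatest) auto
  have H0: "0 \<le> H y" for y by (intro le_H) (auto simp: Delta_plus_nonneg \<nu>)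
  have H1: "H y \<le> 1" for y
    using ne H_le[of _ y] Delta_plus_le_1[OF \<nu>] by (meson all_not_in_conv order_trans)
  have bdd: "bdd_above (H ` S)" for S by (rule bdd_aboveI[of _ 1]) (auto simp: H1)
  have ne': "{y. ereal y < z} \<noteq> {}" if "\<not> z \<le> 0" for z
    using that by (auto intro: exI[of _ "0::real"] simp: zero_ereal_def)
  have H_le_G: "H y \<le> G z" if "0 < z" "ereal y < z" for y z
    using that unfolding G_def by (auto intro: cSUP_upper bdd)
  have G_le: "G z \<le> c" if "0 \<le> c" "\<And>y. 0 < z \<Longrightarrow> ereal y < z \<Longrightarrow> H y \<le> c" for z c
    using that ne'[of z] unfolding G_def by (auto intro!: cSUP_least)
  have G0: "0 \<le> G z" for z
  proof (cases "z \<le> 0")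
    case False
    then have "H 0 \<le> G z" by (intro H_le_G) (auto simp: zero_ereal_def)
    with H0[of 0] show ?thesis by simp
  qed (simp add: G_def)
  have G1: "G z \<le> 1" for z by (intro G_le) (auto simp: H1)
  have mono: "mono G"
    by (intro monoI G_le G0 H_le_G) auto
  have G_less: "\<exists>y. 0 < z \<and> ereal y < z \<and> a < H y" if "a < G z" "0 \<le> a" for a z
    using G_le[of a z] that by (meson not_le)
  have left: "continuous (at_left x) (\<lambda>y. G (ereal y))" for x :: real
    unfolding continuous_within
  proof (rule order_tendstoI)
    fix a assume a: "a < G (ereal x)"
    show "\<forall>\<^sub>F y in at_left x. a < G (ereal y)"
    proof (cases "a < 0")
      case False
      then obtain y where y: "0 < x" "y < x" "a < H y" using G_less[OF a] by auto
      \<comment> \<open>Any \<open>z\<close> in this interval is positive and above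
        \<open>y\<close>, so \<open>H y\<close> is among the values whose supremum is
        \<open>G z\<close>.\<close>
      then have "\<forall>\<^sub>F z in at_left x. z \<in> {max 0 y<..<x}"
        by (intro eventually_at_left_real) simp
      then show ?thesis
        by eventually_elim (use y in \<open>auto intro: less_le_trans[OF _ H_le_G]\<close>)
    qed (simp add: less_le_trans[OF _ G0])
  next
    fix a assume a: "G (ereal x) < a"
    show "\<forall>\<^sub>F y in at_left x. G (ereal y) < a"
      using eventually_at_left_real[of "x - 1" x, simplified]
    proof eventually_elim
      case (elim y)
      then have "G (ereal y) \<le> G (ereal x)" using mono by (auto simp: mono_def)
      with a show ?case by simp
    qed
  qed
  have top: "\<exists>x>0. a < G (ereal x)" if "a < 1" for a
  proof -
    \<comment> \<open>The level halfway between \<open>a\<close> and 1 makes the non-strict uniform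
      bound strict for \<open>a\<close>. Below, \<open>max x 0 + 1\<close> is a positive point
      strictly above \<open>x\<close>, as \<open>H_le_G\<close> requires.\<close>
    have "0 < (1 - a) / 2" using that by simp
    then obtain x where "\<And>p. p \<in> A \<Longrightarrow> 1 - (1 - a) / 2 \<le> \<nu> p (ereal x)"
      using unif by blast
    then have "1 - (1 - a) / 2 \<le> H x" by (rule le_H)
    then have "a < H x" using that by (simp add: field_simps)
    also have "H x \<le> G (ereal (max x 0 + 1))" by (rule H_le_G) auto
    finally show ?thesis by (intro exI[of _ "max x 0 + 1"]) auto
  qed
  have lim: "((\<lambda>x::real. G (ereal x)) \<longlongrightarrow> 1) at_top"
  proof (rule order_tendstoI)
    fix a :: real assume "a < 1"
    then obtain x where x: "a < G (ereal x)" using top by blast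
    show "\<forall>\<^sub>F y in at_top. a < G (ereal y)"
      using eventually_ge_at_top[of x]
    proof eventually_elim
      case (elim y)
      then have "G (ereal x) \<le> G (ereal y)" using mono by (auto simp: mono_def)
      with x show ?case by simp
    qed
  next
    fix a :: real assume "1 < a"
    then show "\<forall>\<^sub>F y in at_top. G (ereal y) < a"
      using G1 by (intro always_eventually) (auto intro: le_less_trans)
  qed
  have "G \<infinity> = 1"
  proof (rule antisym[OF G1], rule dense_le)
    fix a :: real assume "a < 1"
    then obtain x where "a < G (ereal x)" using top by blast
    also have "\<dots> \<le> G \<infinity>" using mono by (auto simp: mono_def)
    finally show "a \<le> G \<infinity>" by simp
  qed
  moreover have "G (-\<infinity>) = 0" "G 0 = 0" by (auto simp: G_def)
  ultimately have "G \<in> D_plus"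
    using mono left lim G0 G1 by (auto simp: D_plus_def Delta_plus_def)
  moreover have "G \<le> \<nu> p" if "p \<in> A" for p
  proof (rule le_funI, rule G_le)
    fix y z assume "ereal y < z"
    then show "H y \<le> \<nu> p z"
      using H_le[OF that, of y] Delta_plus_mono[OF \<nu>[OF that], of "ereal y" z] by (auto intro: order_trans)
  qed (simp add: Delta_plus_nonneg \<nu> that)
  ultimately show ?thesis by (auto simp: D_bounded_def)
qed

section \<open>The strong topology\<close>

lemma Serstnev_space_simps:
  assumes "Serstnev_space \<nu> \<tau>"
  shows Serstnev_Delta: "\<nu> p \<in> Delta_plus"
    and Serstnev_eps0: "\<nu> p = eps0 \<longleftrightarrow> p = 0"
    and Serstnev_minus: "\<nu> (- p) = \<nu> p"
    and Serstnev_add: "\<tau> (\<nu> p) (\<nu> q) \<le> \<nu> (p + q)"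
    and Serstnev_continuous: "continuous_triangle_function \<tau>"
  using assms by (auto simp: Serstnev_space_def PN_space_def)

text \<open>Homogeneity with \<open>\<alpha> = inverse r\<close>, in the form matching the scales of
  \<open>gauge_fun\<close>: shrinking a vector stretches the argument.\<close>

lemma Serstnev_divideR:
  assumes "Serstnev_space \<nu> \<tau>" "0 < r" "0 < x"
  shows "\<nu> (p /\<^sub>R r) (ereal x) = \<nu> p (ereal (r * x))"
proof -
  have "\<nu> (inverse r *\<^sub>R p) (ereal x) = \<nu> p (ereal (x / \<bar>inverse r\<bar>))"
    using assms by (simp add: Serstnev_space_def)
  then show ?thesis using assms(2) by (simp add: field_simps)
qed

lemma strong_nbhd_self:
  assumes "Serstnev_space \<nu> \<tau>" "0 < t"
  shows "p \<in> strong_nbhd \<nu> p t"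
  using assms Serstnev_eps0[OF assms(1), of 0] by (simp add: strong_nbhd_def eps0_def)

lemma strong_nbhd_mono:
  assumes "Serstnev_space \<nu> \<tau>" "s \<le> t"
  shows "strong_nbhd \<nu> p s \<subseteq> strong_nbhd \<nu> p t"
proof
  fix q assume "q \<in> strong_nbhd \<nu> p s"
  moreover have "\<nu> (p - q) (ereal s) \<le> \<nu> (p - q) (ereal t)"
    using assms by (intro Delta_plus_mono[OF Serstnev_Delta]) auto
  ultimately show "q \<in> strong_nbhd \<nu> p t" using assms(2) by (simp add: strong_nbhd_def)
qed

text \<open>Joint continuity of \<open>\<tau>\<close> is applied along the pairs
  \<open>(F, Gs n)\<close>, which tend to \<open>(F, eps0)\<close>; the limit is \<open>F\<close>
  because \<open>eps0\<close> is the identity.\<close>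

lemma triangle_function_conv:
  assumes \<tau>: "continuous_triangle_function \<tau>" and F: "F \<in> Delta_plus"
    and Gs: "\<And>n. Gs n \<in> Delta_plus" and lim: "ddf_conv Gs eps0"
  shows "ddf_conv (\<lambda>n. \<tau> F (Gs n)) F"
proof -
  have tri: "triangle_function \<tau>" and
    cont: "continuous_map (prod_topology weak_topology weak_topology) weak_topology (\<lambda>(F, G). \<tau> F G)"
    using \<tau> by (auto simp: continuous_triangle_function_def)
  have "limitin weak_topology Gs eps0 sequentially"
    using limitin_weak_topology[of Gs eps0] Gs lim eps0_in_Delta_plus by auto
  then have "limitin (prod_topology weak_topology weak_topology) (\<lambda>n. (F, Gs n)) (F, eps0) sequentially"
    using F by (simp add: limitin_pairwise o_def topspace_weak_topology)
  from continuous_map_limit[OF cont this]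
  have "limitin weak_topology (\<lambda>n. \<tau> F (Gs n)) F sequentially"
    using tri F by (simp add: o_def triangle_function_def)
  moreover have "range (\<lambda>n. \<tau> F (Gs n)) \<subseteq> Delta_plus"
    using tri F Gs by (auto simp: triangle_function_def)
  ultimately show ?thesis using limitin_weak_topology F by blast
qed

text \<open>Continuity of \<open>\<tau>\<close> gives no explicit \<open>s\<close>, so the argument
  is by contradiction: points \<open>r n\<close> within radius \<open>inverse (real (Suc n))\<close>
  of \<open>q\<close> but outside the neighbourhood of \<open>p\<close> have
  \<open>\<nu> (q - r n)\<close> tending to \<open>eps0\<close>. Then
  \<open>\<tau> (\<nu> (p - q)) (\<nu> (q - r n))\<close> tends to \<open>\<nu> (p - q)\<close>,
  whose value at \<open>t\<close> exceeds \<open>1 - t\<close>. Lower semicontinuity and the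
  triangle inequality (N3) bring some \<open>r n\<close> back inside.\<close>

lemma strong_nbhd_open:
  assumes S: "Serstnev_space \<nu> \<tau>" and q: "q \<in> strong_nbhd \<nu> p t"
  shows "\<exists>s>0. strong_nbhd \<nu> q s \<subseteq> strong_nbhd \<nu> p t"
proof (rule ccontr)
  assume "\<not> ?thesis"
  then have "\<exists>r. r \<in> strong_nbhd \<nu> q (inverse (real (Suc n))) \<and> r \<notin> strong_nbhd \<nu> p t" for n
    by (metis inverse_positive_iff_positive of_nat_0_less_iff subsetI zero_less_Suc)
  then obtain r where r: "\<And>n. r n \<in> strong_nbhd \<nu> q (inverse (real (Suc n)))"
    "\<And>n. r n \<notin> strong_nbhd \<nu> p t" by metis
  note D = Serstnev_Delta[OF S]
  have tri: "triangle_function \<tau>"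
    using Serstnev_continuous[OF S] by (simp add: continuous_triangle_function_def)
  have "ddf_conv (\<lambda>n. \<nu> (q - r n)) eps0"
    using r(1) by (intro ddf_conv_eps0 D) (simp add: strong_nbhd_def)
  then have "ddf_conv (\<lambda>n. \<tau> (\<nu> (p - q)) (\<nu> (q - r n))) (\<nu> (p - q))"
    by (rule triangle_function_conv[OF Serstnev_continuous[OF S] D D])
  then have "\<forall>\<^sub>F n in sequentially. 1 - t < \<tau> (\<nu> (p - q)) (\<nu> (q - r n)) (ereal t)"
    using q D tri
    by (intro ddf_conv_eventually_gt[of "\<nu> (p - q)"]) (auto simp: strong_nbhd_def triangle_function_def)
  then obtain n where "1 - t < \<tau> (\<nu> (p - q)) (\<nu> (q - r n)) (ereal t)"
    using eventually_happens'[OF sequentially_bot] by blast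
  also have "\<dots> \<le> \<nu> (p - r n) (ereal t)"
    using Serstnev_add[OF S, of "p - q" "q - r n"] by (simp add: le_fun_def)
  finally show False using r(2)[of n] by (simp add: strong_nbhd_def)
qed

text \<open>The generating sets are a priori only a subbase. They form a base because each is a
  neighbourhood of all its points and, at a fixed centre, they are nested by radius.\<close>

lemma openin_strong_topology:
  assumes S: "Serstnev_space \<nu> \<tau>"
  shows "openin (strong_topology \<nu>) U \<longleftrightarrow> (\<forall>q\<in>U. \<exists>s>0. strong_nbhd \<nu> q s \<subseteq> U)"
proof
  assume "openin (strong_topology \<nu>) U"
  then have "generate_topology_on {strong_nbhd \<nu> p t | p t. t > 0} U"
    by (simp add: strong_topology_def openin_topology_generated_by_iff)
  then show "\<forall>q\<in>U. \<exists>s>0. strong_nbhd \<nu> q s \<subseteq> U"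
  proof induction
    case (Int A B)
    show ?case
    proof
      fix q assume "q \<in> A \<inter> B"
      then obtain s t where "0 < s" "strong_nbhd \<nu> q s \<subseteq> A" "0 < t" "strong_nbhd \<nu> q t \<subseteq> B"
        using Int by blast
      then have "strong_nbhd \<nu> q (min s t) \<subseteq> A \<inter> B" "0 < min s t"
        using strong_nbhd_mono[OF S, of "min s t" s q] strong_nbhd_mono[OF S, of "min s t" t q] by auto
      then show "\<exists>s>0. strong_nbhd \<nu> q s \<subseteq> A \<inter> B" by blast
    qed
  next
    case (UN K)
    then show ?case by (meson Union_iff Sup_upper order_trans)
  qed (auto intro: strong_nbhd_open[OF S])
next
  assume U: "\<forall>q\<in>U. \<exists>s>0. strong_nbhd \<nu> q s \<subseteq> U"
  have "\<exists>T. openin (strong_topology \<nu>) T \<and> q \<in> T \<and> T \<subseteq> U" if q: "q \<in> U" for q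
  proof -
    obtain s where s: "0 < s" "strong_nbhd \<nu> q s \<subseteq> U" using bspec[OF U q] by blast
    then have "openin (strong_topology \<nu>) (strong_nbhd \<nu> q s)"
      unfolding strong_topology_def by (intro topology_generated_by_Basis) auto
    with s strong_nbhd_self[OF S] show ?thesis by blast
  qed
  then show "openin (strong_topology \<nu>) U" by (subst openin_subopen) blast
qed

text \<open>Translation invariance; (N2) repairs the sign, since membership at the null vector tests
  \<open>0 - (p - q)\<close>.\<close>

lemma mem_strong_nbhd_iff:
  assumes "Serstnev_space \<nu> \<tau>"
  shows "q \<in> strong_nbhd \<nu> p t \<longleftrightarrow> p - q \<in> strong_nbhd \<nu> 0 t"
  using Serstnev_minus[OF assms, of "p - q"] by (simp add: strong_nbhd_def)

lemma openin_norm_topology: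
  assumes "is_norm N"
  shows "openin (Metric_space.mtopology UNIV (\<lambda>x y. N (x - y))) U \<longleftrightarrow>
    (\<forall>q\<in>U. \<exists>e>0. {r. N (q - r) < e} \<subseteq> U)"
proof -
  interpret Metric_space UNIV "\<lambda>x y. N (x - y)" by (rule Metric_space_is_norm[OF assms])
  show ?thesis by (auto simp: openin_mtopology mball_def)
qed

text \<open>Hypothesis \<open>1\<close> makes strongly open sets norm open and \<open>2\<close>
  gives the converse, after translating the centre to \<open>q\<close>.\<close>

lemma norm_topology_eq_strong_topology:
  assumes S: "Serstnev_space \<nu> \<tau>" and N: "is_norm N"
    and 1: "\<And>s. 0 < s \<Longrightarrow> \<exists>e>0. {p. N p < e} \<subseteq> strong_nbhd \<nu> 0 s"
    and 2: "\<And>e. 0 < e \<Longrightarrow> \<exists>s>0. strong_nbhd \<nu> 0 s \<subseteq> {p. N p < e}"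
  shows "Metric_space.mtopology UNIV (\<lambda>x y. N (x - y)) = strong_topology \<nu>"
  unfolding topology_eq openin_norm_topology[OF N] openin_strong_topology[OF S]
proof (intro allI iffI ballI)
  fix U q assume "\<forall>q\<in>U. \<exists>e>0. {r. N (q - r) < e} \<subseteq> U" "q \<in> U"
  then obtain e where e: "0 < e" "{r. N (q - r) < e} \<subseteq> U" by blast
  then obtain s where "0 < s" "strong_nbhd \<nu> 0 s \<subseteq> {p. N p < e}" using 2 by blast
  with e show "\<exists>s>0. strong_nbhd \<nu> q s \<subseteq> U" using mem_strong_nbhd_iff[OF S, of _ q s] by blast
next
  fix U q assume "\<forall>q\<in>U. \<exists>s>0. strong_nbhd \<nu> q s \<subseteq> U" "q \<in> U"
  then obtain s where s: "0 < s" "strong_nbhd \<nu> q s \<subseteq> U" by blast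
  then obtain e where "0 < e" "{p. N p < e} \<subseteq> strong_nbhd \<nu> 0 s" using 1 by blast
  with s show "\<exists>e>0. {r. N (q - r) < e} \<subseteq> U" using mem_strong_nbhd_iff[OF S, of _ q s] by blast
qed

section \<open>Normability\<close>

lemma is_norm_convex_ball:
  assumes "is_norm N"
  shows "convex {p. N p < e}"
proof (rule convexI, clarify)
  fix x y and u v :: real
  assume xy: "N x < e" "N y < e" and uv: "0 \<le> u" "0 \<le> v" "u + v = 1"
  have "N (u *\<^sub>R x + v *\<^sub>R y) \<le> N (u *\<^sub>R x) + N (v *\<^sub>R y)"
    using assms unfolding is_norm_def by blast
  also have "\<dots> = u * N x + v * N y" using assms uv by (simp add: is_norm_def)
  also have "\<dots> < e" using xy uv by (rule convex_bound_lt)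
  finally show "N (u *\<^sub>R x + v *\<^sub>R y) < e" .
qed

text \<open>The open unit ball works. For each \<open>e\<close> some norm ball of radius
  \<open>d\<close> lies in the strong neighbourhood of radius \<open>e\<close>; rescaling by
  \<open>d\<close> gives the bound \<open>1 - e\<close> at \<open>e / d\<close>, uniformly over the
  unit ball, as \<open>D_boundedI\<close> requires.\<close>

lemma normable_imp_convex_bounded_nbhd:
  assumes S: "Serstnev_space \<nu> \<tau>" and norm: "normable \<nu>"
  shows "\<exists>U. openin (strong_topology \<nu>) U \<and> 0 \<in> U \<and> convex U \<and> D_bounded \<nu> U"
proof -
  obtain N where N: "is_norm N"
    and eq: "Metric_space.mtopology UNIV (\<lambda>x y. N (x - y)) = strong_topology \<nu>"
    using norm by (auto simp: normable_def)
  interpret Metric_space UNIV "\<lambda>x y. N (x - y)" by (rule Metric_space_is_norm[OF N])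
  have N0: "N 0 = 0" and N_minus: "N (- x) = N x" for x
    using N commute[of 0 x] by (auto simp: is_norm_def)
  define B where "B = {p. N p < 1}"
  have "mball 0 1 = B" by (auto simp: B_def mball_def N_minus)
  then have "openin (strong_topology \<nu>) B" using openin_mball[of 0 1] eq by simp
  moreover have "0 \<in> B" by (simp add: B_def N0)
  moreover have "convex B" unfolding B_def by (rule is_norm_convex_ball[OF N])
  moreover have "D_bounded \<nu> B"
  proof (rule D_boundedI)
    fix e :: real assume e: "0 < e"
    have "openin (strong_topology \<nu>) (strong_nbhd \<nu> 0 e)"
      using strong_nbhd_open[OF S] by (auto simp: openin_strong_topology[OF S])
    then obtain d where d: "0 < d" "{r. N (0 - r) < d} \<subseteq> strong_nbhd \<nu> 0 e"
      using strong_nbhd_self[OF S e] unfolding eq[symmetric] openin_norm_topology[OF N] by blast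
    have "1 - e \<le> \<nu> p (ereal (e / d))" if "p \<in> B" for p
    proof -
      have "N (d *\<^sub>R p) < d" using that N d by (simp add: is_norm_def B_def)
      then have "d *\<^sub>R p \<in> strong_nbhd \<nu> 0 e" using d by (auto simp: N_minus)
      moreover have "\<nu> (d *\<^sub>R p) (ereal e) = \<nu> p (ereal (e / d))"
        using Serstnev_divideR[OF S, of "inverse d" e p] d e by (simp add: field_simps)
      ultimately show ?thesis by (simp add: strong_nbhd_def Serstnev_minus[OF S])
    qed
    then show "\<exists>x::real. \<forall>p\<in>B. 1 - e \<le> \<nu> p (ereal x)" by blast
  qed (use \<open>0 \<in> B\<close> Serstnev_Delta[OF S] in auto)
  ultimately show ?thesis by blast
qed

text \<open>The gauge of the symmetrised set is controlled from both sides. The bound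
  \<open>G\<close> turns a small gauge into large values of \<open>\<nu> p\<close>, giving
  definiteness and gauge balls inside strong neighbourhoods; the strong neighbourhood of radius
  \<open>t\<close> inside \<open>A\<close> gives absorption and the reverse inclusion.\<close>

lemma convex_bounded_nbhd_imp_normable:
  assumes S: "Serstnev_space \<nu> \<tau>" and char: "characteristic \<nu>"
    and U: "openin (strong_topology \<nu>) U" "0 \<in> U" "U \<subseteq> A" and A: "convex A" "D_bounded \<nu> A"
  shows "normable \<nu>"
proof -
  obtain t where t: "0 < t" "strong_nbhd \<nu> 0 t \<subseteq> A"
    using bspec[OF iffD1[OF openin_strong_topology[OF S] U(1)] U(2)] U(3) by blast
  obtain G where G: "G \<in> D_plus" "\<And>p. p \<in> A \<Longrightarrow> G \<le> \<nu> p"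
    using A by (auto simp: D_bounded_def)
  then have G_Delta: "G \<in> Delta_plus" by (simp add: D_plus_def)
  define K where "K = A \<inter> uminus ` A"
  have mem_K: "p \<in> K \<longleftrightarrow> p \<in> A \<and> - p \<in> A" for p
    unfolding K_def by (metis IntD1 IntD2 IntI imageE imageI minus_minus)
  have "convex K" unfolding K_def by (intro convex_Int A convex_negations)
  have nbhd_K: "p \<in> K" if "1 - t < \<nu> p (ereal t)" for p
    using that t by (auto simp: mem_K strong_nbhd_def Serstnev_minus[OF S])
  \<comment> \<open>The characteristic property enters here: \<open>\<nu> p\<close> exceeds
    \<open>1 - t\<close> at some \<open>x\<close>, and dividing \<open>p\<close> by
    \<open>x / t\<close> moves that value to the argument \<open>t\<close>.\<close>
  have absb: "\<exists>r>0. p /\<^sub>R r \<in> K" for p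
  proof -
    have "\<nu> p \<in> D_plus" using char by (simp add: characteristic_def)
    then obtain x where x: "0 < x" "1 - t < \<nu> p (ereal x)"
      using D_plus_eventually[of "\<nu> p" "1 - t"] t by auto
    have "\<nu> (p /\<^sub>R (x / t)) (ereal t) = \<nu> p (ereal (x / t * t))"
      using x t by (intro Serstnev_divideR[OF S]) auto
    then have "p /\<^sub>R (x / t) \<in> K" using x t by (intro nbhd_K) simp
    then show ?thesis using x t by (meson divide_pos_pos)
  qed
  \<comment> \<open>A gauge below \<open>s / x\<close> provides a scale \<open>r\<close> with
    \<open>x < s / r\<close>, so the bound \<open>G\<close> for \<open>p /\<^sub>R r\<close> at
    \<open>s / r\<close> becomes a bound for \<open>p\<close> at \<open>s\<close>.\<close>
  have small: "a < \<nu> p (ereal s)" if "0 < s" "0 < x" "a < G (ereal x)"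
    and less: "gauge_fun K p < s / x" for a s x p
  proof -
    obtain r where r: "0 < r" "r < s / x" "p /\<^sub>R r \<in> K"
      using gauge_fun_lessE[OF absb less] by blast
    have "G (ereal x) \<le> G (ereal (s / r))"
      using r that by (intro Delta_plus_mono[OF G_Delta]) (simp add: field_simps)
    also have "\<dots> \<le> \<nu> (p /\<^sub>R r) (ereal (s / r))"
      using G(2)[of "p /\<^sub>R r"] r mem_K by (auto simp: le_fun_def)
    also have "\<dots> = \<nu> p (ereal s)"
      using Serstnev_divideR[OF S, of r "s / r" p] r that by simp
    finally show ?thesis using that by simp
  qed
  \<comment> \<open>A nonpositive gauge lies below every \<open>s / x\<close>, so
    \<open>small\<close> applies at all \<open>s > 0\<close> and all levels below 1; then
    \<open>\<nu> p = eps0\<close>, and (N1) gives \<open>p = 0\<close>.\<close>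
  have "0 < gauge_fun K p" if "p \<noteq> 0" for p
  proof (rule ccontr)
    assume "\<not> ?thesis"
    then have g: "gauge_fun K p \<le> 0" by simp
    have "\<nu> p = eps0"
    proof (rule Delta_plus_eq_eps0[OF Serstnev_Delta[OF S]], rule dense_le)
      fix s a :: real assume "0 < s" "a < 1"
      then obtain x where "0 < x" "a < G (ereal x)" using D_plus_eventually[OF G(1)] by blast
      with g \<open>0 < s\<close> show "a \<le> \<nu> p (ereal s)"
        by (intro less_imp_le small[of s x]) (auto intro: le_less_trans)
    qed
    with that show False by (simp add: Serstnev_eps0[OF S])
  qed
  then have norm: "is_norm (gauge_fun K)"
    using \<open>convex K\<close> absb by (intro is_norm_gauge_fun) (auto simp: mem_K)
  have "\<exists>e>0. {p. gauge_fun K p < e} \<subseteq> strong_nbhd \<nu> 0 s" if s: "0 < s" for s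
  proof -
    obtain x where x: "0 < x" "1 - s < G (ereal x)" using D_plus_eventually[OF G(1), of "1 - s"] s by auto
    then have "{p. gauge_fun K p < s / x} \<subseteq> strong_nbhd \<nu> 0 s"
      using small[OF s] by (auto simp: strong_nbhd_def Serstnev_minus[OF S])
    with s x show ?thesis by (meson divide_pos_pos)
  qed
  moreover have "\<exists>s>0. strong_nbhd \<nu> 0 s \<subseteq> {p. gauge_fun K p < e}" if e: "0 < e" for e
  proof -
    \<comment> \<open>Halving \<open>e\<close> leaves room because \<open>gauge_fun_le\<close> gives
      only a non-strict bound by \<open>c\<close>. In \<open>s\<close>, the bound \<open>t\<close>
      keeps the level \<open>1 - s\<close> at least \<open>1 - t\<close>, and the bound
      \<open>c * t\<close> lets division by \<open>c\<close> carry the value to the argument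
      \<open>t\<close>.\<close>
    define c where "c = e / 2"
    define s where "s = min (c * t) t"
    have c: "0 < c" "c < e" using e by (auto simp: c_def)
    then have s: "0 < s" "s \<le> c * t" "s \<le> t" using t by (auto simp: s_def)
    have "gauge_fun K q < e" if "q \<in> strong_nbhd \<nu> 0 s" for q
    proof -
      have "1 - t < \<nu> q (ereal s)"
        using that s by (simp add: strong_nbhd_def Serstnev_minus[OF S])
      also have "\<dots> \<le> \<nu> q (ereal (c * t))"
        using s by (intro Delta_plus_mono[OF Serstnev_Delta[OF S]]) auto
      also have "\<dots> = \<nu> (q /\<^sub>R c) (ereal t)" using Serstnev_divideR[OF S] c t by simp
      finally have "gauge_fun K q \<le> c" using c by (intro gauge_fun_le nbhd_K)
      with c show ?thesis by simp
    qed
    with s show ?thesis by blast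
  qed
  ultimately show ?thesis
    unfolding normable_def using norm norm_topology_eq_strong_topology[OF S norm] by blast
qed

theorem theorem6:
  fixes \<nu> :: "'a::real_vector \<Rightarrow> ereal \<Rightarrow> real"
    and \<tau> :: "(ereal \<Rightarrow> real) \<Rightarrow> (ereal \<Rightarrow> real) \<Rightarrow> (ereal \<Rightarrow> real)"
  assumes "Serstnev_space \<nu> \<tau>"
    and "characteristic \<nu>"
  shows "normable \<nu> \<longleftrightarrow>
    (\<exists>A U. openin (strong_topology \<nu>) U \<and> 0 \<in> U \<and> U \<subseteq> A \<and> convex A \<and> D_bounded \<nu> A)"
  \<comment> \<open>From left to right, the same open set serves as \<open>A\<close> and as
    \<open>U\<close>.\<close>
  using normable_imp_convex_bounded_nbhd[OF assms(1)]
    convex_bounded_nbhd_imp_normable[OF assms] by (meson order_refl)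

end
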